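(* Let $Y$ be a topological space with a regular $G_\delta$-diagonal, let $(X_t:t\in T)$ be a family of topological spaces, $X=\prod_{t\in T}X_t$, $a\in X$, and let $E\subseteq X$ be a pseudo-$\aleph_1$-compact subspace which is $(\aleph_1,\aleph_0)$-invariant with respect to $a$. Then for any continuous mapping $f:E\to Y$ there exist a countable set $T_0\subseteq T$ and a continuous mapping $f_0:p_{T_0}(E)\to Y$ such that $f=f_0\circ (p_{T_0}|_E)$. In particular, $f$ depends on countably many coordinates.
   Context: Products carry the product topology and subsets the subspace topology. Countable means of cardinality $\le\aleph_0$. For $S\subseteq T$, $p_S:X\to\prod_{t\in S}X_t$ is the projection $p_S(x)=(x_t)_{t\in S}$. For $a=(a_t)_{t\in T}\in X$, $x=(x_t)_{t\in T}\in X$ and $S\subseteq T$, $x_S^a\in X$ denotes the point $(y_t)_{t\in T}$ with $y_t=x_t$ if $t\in S$ and $y_t=a_t$ if $t\in T\setminus S$. For infinite cardinals $\aleph_i,\aleph_j$, a set $E\subseteq X$ and $a\in E$, the set $E$ is $(\aleph_i,\aleph_j)$-invariant with respect to $a$ if $x_{S_1}^a\in E$ and $x_{T\setminus S_2}^a\in E$ for every $x\in E$ and all sets $S_1,S_2\subseteq T$ with $|S_1|<\aleph_i$ and $|S_2|<\aleph_j$. A topological space is pseudo-$\aleph_1$-compact if every locally finite family of non-empty open subsets of it is at most countable. A space $Y$ has a regular $G_\delta$-diagonal if there is a sequence $(G_n)_{n=1}^\infty$ of open subsets of $Y^2$ such that $\{(y,y):y\in Y\}=\bigcap_{n=1}^\infty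 G_n=\bigcap_{n=1}^\infty\overline{G_n}$. A function $f:E\to Y$ depends on a set $S\subseteq T$ if for all $x,y\in E$ the equality $p_S(x)=p_S(y)$ implies $f(x)=f(y)$; $f$ depends on countably many coordinates if it depends on some $S$ with $|S|\le\aleph_0$. *)

theory Defs
  imports "HOL-Analysis.Analysis" "HOL-Library.Countable_Set_Type"
begin

unbundle cardinal_syntax

text \<open>
  The family of spaces is \<open>X :: 'i \<Rightarrow> 'a topology\<close> with index set \<open>T\<close>. Its product is
  \<open>product_topology X T\<close>, whose points are functions that are \<open>undefined\<close> outside \<open>T\<close>;
  the projection \<open>p\<^sub>S\<close> onto the coordinates in \<open>S\<close> is therefore \<open>\<lambda>x. restrict x S\<close>.
\<close>

definition replace_off :: "'i set \<Rightarrow> ('i \<Rightarrow> 'a) \<Rightarrow> 'i set \<Rightarrow> ('i \<Rightarrow> 'a) \<Rightarrow> ('i \<Rightarrow> 'a)" where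
  "replace_off T a S x = (\<lambda>t\<in>T. if t \<in> S then x t else a t)"

text \<open>Infinite cardinals are represented by cardinal orders: \<open>natLeq\<close> is $\aleph_0$ and
  \<open>cardSuc natLeq\<close> is $\aleph_1$.\<close>

definition invariant_wrt ::
    "'k rel \<Rightarrow> 'l rel \<Rightarrow> 'i set \<Rightarrow> ('i \<Rightarrow> 'a) set \<Rightarrow> ('i \<Rightarrow> 'a) \<Rightarrow> bool" where
  "invariant_wrt \<kappa> \<mu> T E a \<longleftrightarrow>
     a \<in> E \<and>
     (\<forall>x\<in>E. \<forall>S1 S2. S1 \<subseteq> T \<and> S2 \<subseteq> T \<and> |S1| <o \<kappa> \<and> |S2| <o \<mu> \<longrightarrow>
        replace_off T a S1 x \<in> E \<and> replace_off T a (T - S2) x \<in> E)"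

lemma card_less_aleph0_iff: "|S| <o natLeq \<longleftrightarrow> finite S"
  by (simp add: finite_iff_ordLess_natLeq)

lemma card_less_aleph1_iff: "|S| <o cardSuc natLeq \<longleftrightarrow> countable S"
  using cardSuc_ordLeq_ordLess[OF natLeq_Card_order card_of_Card_order]
  by (simp add: countable_card_le_natLeq)

text \<open>Sets of open sets are enough here: in an indexed locally finite family, each non-empty
  member is repeated only finitely often.\<close>

definition pseudo_aleph1_compact :: "'a topology \<Rightarrow> bool" where
  "pseudo_aleph1_compact Z \<longleftrightarrow>
     (\<forall>\<U>. (\<forall>U\<in>\<U>. openin Z U \<and> U \<noteq> {}) \<and> locally_finite_in Z \<U> \<longrightarrow> countable \<U>)"

definition regular_Gdelta_diagonal :: "'b topology \<Rightarrow> bool" where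
  "regular_Gdelta_diagonal Y \<longleftrightarrow>
     (\<exists>G :: nat \<Rightarrow> ('b \<times> 'b) set.
        (\<forall>n. openin (prod_topology Y Y) (G n)) \<and>
        {(y, y) | y. y \<in> topspace Y} = (\<Inter>n. G n) \<and>
        {(y, y) | y. y \<in> topspace Y} = (\<Inter>n. prod_topology Y Y closure_of G n))"

definition depends_on :: "('i \<Rightarrow> 'a) set \<Rightarrow> (('i \<Rightarrow> 'a) \<Rightarrow> 'b) \<Rightarrow> 'i set \<Rightarrow> bool" where
  "depends_on E f S \<longleftrightarrow> (\<forall>x\<in>E. \<forall>y\<in>E. restrict x S = restrict y S \<longrightarrow> f x = f y)"

definition depends_on_countably_many ::
    "'i set \<Rightarrow> ('i \<Rightarrow> 'a) set \<Rightarrow> (('i \<Rightarrow> 'a) \<Rightarrow> 'b) \<Rightarrow> bool" where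
  "depends_on_countably_many T E f \<longleftrightarrow> (\<exists>S\<subseteq>T. countable S \<and> depends_on E f S)"

end

theory Submission
  imports Defs
begin

text \<open>
  Resetting a finite set \<open>F\<close> of coordinates to those of \<open>a\<close> maps \<open>E\<close> to itself, by the
  \<open>\<aleph>\<^sub>0\<close> half of invariance. For an open neighbourhood \<open>G\<close> of the diagonal of \<open>Y\<close>, call \<open>F\<close>
  a \<^emph>\<open>jump set\<close> of \<open>f\<close> for \<open>G\<close> if, on some non-empty open subset of \<open>E\<close>, this reset moves the
  value of \<open>f\<close> so far that the old and the new value form a pair outside \<open>G\<close>.

  Two facts about jump sets carry the proof. First, a pairwise disjoint family of jump sets for one
  \<open>G\<close> is countable (\<open>countable_disjoint_jump_sets\<close>). Otherwise pseudo-\<open>\<aleph>\<^sub>1\<close>-compactness yields a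
  point \<open>z\<close> at which the corresponding open sets accumulate. Near \<open>z\<close> all pairs of values of \<open>f\<close>
  lie in \<open>G\<close>, and a basic neighbourhood of \<open>z\<close> restricts only finitely many coordinates, so it is
  stable under resetting any single one of all but finitely many of the disjoint sets; this
  contradicts the jump.
  Second, if \<open>S\<close> is countable and resetting all coordinates outside \<open>S\<close> changes some value of
  \<open>f\<close>, then the change is already visible on a jump set disjoint from \<open>S\<close>, for one of the sets \<open>G\<^sub>n\<close>
  that witness the regular \<open>G\<^sub>\<delta>\<close>-diagonal (\<open>jump_set_outside\<close>).

  Now choose for every \<open>n\<close> a maximal disjoint family of jump sets for \<open>G\<^sub>n\<close>, and let \<open>T0\<close> be the
  union of all these families. It is countable, and by maximality no jump set is disjoint from it,
  since a jump set is never empty.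
  Hence \<open>f x\<close> is the value of \<open>f\<close> at the point that agrees with \<open>x\<close> on \<open>T0\<close> and with \<open>a\<close>
  elsewhere. That point lies in \<open>E\<close> by the \<open>\<aleph>\<^sub>1\<close> half of invariance and depends continuously on
  the projection of \<open>x\<close> to \<open>T0\<close>, so this formula also provides the continuous factor.
\<close>

section \<open>Topological preliminaries\<close>

text \<open>
  An uncountable index set need not give uncountably many different sets. If it does, the failure
  of local finiteness gives the point; if not, one set is repeated infinitely often, and any of
  its points will do.
\<close>

lemma pseudo_aleph1_compact_accumulation:
  assumes Z: "pseudo_aleph1_compact Z" and I: "uncountable I"
    and U: "\<forall>i\<in>I. openin Z (U i) \<and> U i \<noteq> {}"
  shows "\<exists>z\<in>topspace Z. \<forall>V. openin Z V \<longrightarrow> z \<in> V \<longrightarrow> infinite {i \<in> I. U i \<inter> V \<noteq> {}}"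
proof (cases "countable (U ` I)")
  case True
  have "\<exists>u\<in>U ` I. infinite {i \<in> I. U i = u}"
  proof (rule ccontr)
    assume "\<not> ?thesis"
    then have "countable (\<Union>u\<in>U ` I. {i \<in> I. U i = u})"
      using True by (intro countable_UN) (auto intro: countable_finite)
    moreover have "(\<Union>u\<in>U ` I. {i \<in> I. U i = u}) = I"
      by auto
    ultimately show False
      using I by simp
  qed
  then obtain j where j: "j \<in> I" "infinite {i \<in> I. U i = U j}"
    by auto
  then obtain z where z: "z \<in> U j"
    using U by blast
  show ?thesis
  proof (intro bexI allI impI)
    show "z \<in> topspace Z"
      using z openin_subset[of Z "U j"] U j(1) by blast
    fix V assume "openin Z V" "z \<in> V"
    then have "{i \<in> I. U i = U j} \<subseteq> {i \<in> I. U i \<inter> V \<noteq> {}}"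
      using z by blast
    then show "infinite {i \<in> I. U i \<inter> V \<noteq> {}}"
      using j(2) by (rule infinite_super)
  qed
next
  case False
  moreover have "\<forall>u\<in>U ` I. openin Z u \<and> u \<noteq> {}"
    using U by simp
  ultimately have "\<not> locally_finite_in Z (U ` I)"
    using Z unfolding pseudo_aleph1_compact_def by metis
  moreover have "\<Union> (U ` I) \<subseteq> topspace Z"
    using U by (simp add: UN_subset_iff openin_subset)
  ultimately obtain z where z: "z \<in> topspace Z"
    and inf: "\<And>V. openin Z V \<Longrightarrow> z \<in> V \<Longrightarrow> infinite {u \<in> U ` I. u \<inter> V \<noteq> {}}"
    unfolding locally_finite_in_def by metis
  show ?thesis
  proof (intro bexI[OF _ z] allI impI)
    fix V assume "openin Z V" "z \<in> V"
    then have "infinite {u \<in> U ` I. u \<inter> V \<noteq> {}}"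
      by (rule inf)
    moreover have "{u \<in> U ` I. u \<inter> V \<noteq> {}} = U ` {i \<in> I. U i \<inter> V \<noteq> {}}"
      by auto
    ultimately show "infinite {i \<in> I. U i \<inter> V \<noteq> {}}"
      by auto
  qed
qed

lemma openin_subtopology_product_box:
  assumes "openin (subtopology (product_topology X T) E) W" and "x \<in> W"
  shows "\<exists>B. finite {i \<in> T. B i \<noteq> topspace (X i)} \<and> (\<forall>i\<in>T. openin (X i) (B i)) \<and>
           x \<in> Pi\<^sub>E T B \<and> Pi\<^sub>E T B \<inter> E \<subseteq> W"
proof -
  obtain W' where W': "openin (product_topology X T) W'" "W = W' \<inter> E"
    using assms(1) unfolding openin_subtopology by blast
  then obtain B where "finite {i \<in> T. B i \<noteq> topspace (X i)}" "\<forall>i\<in>T. openin (X i) (B i)"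
    "x \<in> Pi\<^sub>E T B" "Pi\<^sub>E T B \<subseteq> W'"
    using assms(2) unfolding openin_product_topology_alt by blast
  with W' show ?thesis
    by blast
qed

lemma replace_off_all: "x \<in> extensional T \<Longrightarrow> replace_off T a T x = x"
  by (auto simp: replace_off_def restrict_def extensional_def)

lemma replace_off_restrict: "replace_off T a S (restrict x S) = replace_off T a S x"
  by (auto simp: replace_off_def)

lemma continuous_map_replace_off:
  assumes "S \<subseteq> T" and "a \<in> topspace (product_topology X T)"
  shows "continuous_map (product_topology X S) (product_topology X T) (replace_off T a S)"
  unfolding continuous_map_componentwise
proof (intro conjI ballI)
  show "replace_off T a S ` topspace (product_topology X S) \<subseteq> extensional T"
    by (auto simp: replace_off_def)
  fix k assume k: "k \<in> T"
  have "continuous_map (product_topology X S) (X k) (\<lambda>x. if k \<in> S then x k else a k)"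
    using k assms(2) by (cases "k \<in> S") (auto simp: continuous_map_product_projection PiE_iff)
  then show "continuous_map (product_topology X S) (X k) (\<lambda>x. replace_off T a S x k)"
    using k by (simp add: replace_off_def)
qed

section \<open>Jump sets\<close>

definition jump_set ::
    "'i set \<Rightarrow> ('i \<Rightarrow> 'a topology) \<Rightarrow> ('i \<Rightarrow> 'a) \<Rightarrow> ('i \<Rightarrow> 'a) set \<Rightarrow> (('i \<Rightarrow> 'a) \<Rightarrow> 'b) \<Rightarrow>
      ('b \<times> 'b) set \<Rightarrow> 'i set \<Rightarrow> bool" where
  "jump_set T X a E f G F \<longleftrightarrow> finite F \<and> F \<subseteq> T \<and>
     (\<exists>U. openin (subtopology (product_topology X T) E) U \<and> U \<noteq> {} \<and>
          (\<forall>w\<in>U. (f w, f (replace_off T a (T - F) w)) \<notin> G))"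

text \<open>Resetting no coordinate leaves the value of \<open>f\<close> unchanged, and diagonal pairs lie in \<open>G\<close>.\<close>

lemma jump_set_nonempty:
  assumes jump: "jump_set T X a E f G F"
    and f: "continuous_map (subtopology (product_topology X T) E) Y f"
    and diag: "\<And>y. y \<in> topspace Y \<Longrightarrow> (y, y) \<in> G"
  shows "F \<noteq> {}"
proof
  assume "F = {}"
  then obtain U w where U: "openin (subtopology (product_topology X T) E) U" and w: "w \<in> U"
    and out: "(f w, f (replace_off T a T w)) \<notin> G"
    using jump unfolding jump_set_def by auto
  have w': "w \<in> topspace (subtopology (product_topology X T) E)"
    using U w openin_subset by blast
  then have "w \<in> extensional T"
    by (auto simp: PiE_def)
  moreover have "f w \<in> topspace Y"
    using w' continuous_map_image_subset_topspace[OF f] by blast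
  ultimately show False
    using out diag by (simp add: replace_off_all)
qed

lemma countable_disjoint_jump_sets:
  assumes a: "a \<in> topspace (product_topology X T)"
    and comp: "pseudo_aleph1_compact (subtopology (product_topology X T) E)"
    and inv: "\<And>x F. x \<in> E \<Longrightarrow> finite F \<Longrightarrow> F \<subseteq> T \<Longrightarrow> replace_off T a (T - F) x \<in> E"
    and f: "continuous_map (subtopology (product_topology X T) E) Y f"
    and G: "openin (prod_topology Y Y) G"
    and diag: "\<And>y. y \<in> topspace Y \<Longrightarrow> (y, y) \<in> G"
    and jump: "\<And>F. F \<in> \<F> \<Longrightarrow> jump_set T X a E f G F"
    and disj: "pairwise disjnt \<F>"
  shows "countable \<F>"
proof (rule ccontr)
  let ?Z = "subtopology (product_topology X T) E"
  assume unc: "uncountable \<F>"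
  have "\<forall>F\<in>\<F>. \<exists>U. openin ?Z U \<and> U \<noteq> {} \<and> (\<forall>w\<in>U. (f w, f (replace_off T a (T - F) w)) \<notin> G)"
    using jump unfolding jump_set_def by blast
  then obtain U where U: "\<forall>F\<in>\<F>. openin ?Z (U F) \<and> U F \<noteq> {}"
    and out: "\<And>F w. F \<in> \<F> \<Longrightarrow> w \<in> U F \<Longrightarrow> (f w, f (replace_off T a (T - F) w)) \<notin> G"
    by metis
  obtain z where z: "z \<in> topspace ?Z"
    and acc: "\<forall>V. openin ?Z V \<longrightarrow> z \<in> V \<longrightarrow> infinite {F \<in> \<F>. U F \<inter> V \<noteq> {}}"
    using pseudo_aleph1_compact_accumulation[OF comp unc U] by (elim bexE)
  have "f z \<in> topspace Y"
    using continuous_map_image_subset_topspace[OF f] imageI[OF z] by (rule subsetD)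
  from openin_prod_topology_alt[THEN iffD1, OF G, rule_format, OF diag[OF this]]
  obtain A B where AB: "openin Y A" "openin Y B" "f z \<in> A" "f z \<in> B" "A \<times> B \<subseteq> G"
    by (elim exE conjE)
  have op: "openin ?Z {w \<in> topspace ?Z. f w \<in> A \<inter> B}"
    using f AB by (intro openin_continuous_map_preimage) auto
  have "z \<in> {w \<in> topspace ?Z. f w \<in> A \<inter> B}"
    using z AB by simp
  from openin_subtopology_product_box[OF op this]
  obtain C where fin: "finite {i \<in> T. C i \<noteq> topspace (X i)}"
    and C: "\<forall>i\<in>T. openin (X i) (C i)" "z \<in> Pi\<^sub>E T C"
    and sub: "Pi\<^sub>E T C \<inter> E \<subseteq> {w \<in> topspace ?Z. f w \<in> A \<inter> B}"
    by (elim exE conjE)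
  define Q where "Q = {i \<in> T. C i \<noteq> topspace (X i)}"
  have "openin (product_topology X T) (Pi\<^sub>E T C)"
    using fin C by (simp add: openin_PiE_gen)
  then have "openin ?Z (Pi\<^sub>E T C \<inter> E)"
    unfolding openin_subtopology by blast
  moreover have "z \<in> Pi\<^sub>E T C \<inter> E"
    using C z by simp
  ultimately have "infinite {F \<in> \<F>. U F \<inter> (Pi\<^sub>E T C \<inter> E) \<noteq> {}}"
    by (rule acc[rule_format])
  \<comment> \<open>Each coordinate lies in at most one member of the disjoint family, so only finitely many
    members meet the finite set \<open>Q\<close> of coordinates that the box restricts.\<close>
  moreover have "finite {F \<in> \<F>. F \<inter> Q \<noteq> {}}"
  proof -
    have "finite {F \<in> \<F>. q \<in> F}" for q
    proof (cases "\<exists>F0\<in>\<F>. q \<in> F0")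
      case True
      then obtain F0 where "F0 \<in> \<F>" "q \<in> F0" by blast
      then have "{F \<in> \<F>. q \<in> F} \<subseteq> {F0}"
        using disj unfolding pairwise_def disjnt_def by blast
      then show ?thesis
        by (rule finite_subset) simp
    next
      case False
      then have "{F \<in> \<F>. q \<in> F} = {}" by blast
      then show ?thesis by (simp only: finite.emptyI)
    qed
    then have "finite (\<Union>q\<in>Q. {F \<in> \<F>. q \<in> F})"
      using fin unfolding Q_def by blast
    moreover have "{F \<in> \<F>. F \<inter> Q \<noteq> {}} = (\<Union>q\<in>Q. {F \<in> \<F>. q \<in> F})"
      by blast
    ultimately show ?thesis by (simp only:)
  qed
  ultimately have "infinite ({F \<in> \<F>. U F \<inter> (Pi\<^sub>E T C \<inter> E) \<noteq> {}} - {F \<in> \<F>. F \<inter> Q \<noteq> {}})"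
    by (rule Diff_infinite_finite[rotated])
  then have "{F \<in> \<F>. U F \<inter> (Pi\<^sub>E T C \<inter> E) \<noteq> {}} - {F \<in> \<F>. F \<inter> Q \<noteq> {}} \<noteq> {}"
    by (rule infinite_imp_nonempty)
  then obtain F where F: "F \<in> \<F>" "F \<inter> Q = {}" and "U F \<inter> (Pi\<^sub>E T C \<inter> E) \<noteq> {}"
    by auto
  then obtain w where w: "w \<in> U F" "w \<in> Pi\<^sub>E T C" "w \<in> E"
    by auto
  let ?w = "replace_off T a (T - F) w"
  have "?w \<in> E"
    using inv w(3) jump[OF F(1)] by (simp add: jump_set_def)
  moreover have "?w \<in> Pi\<^sub>E T C"
    using w F a by (auto simp: replace_off_def Q_def PiE_iff)
  ultimately have "f w \<in> A" "f ?w \<in> B"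
    using sub w by auto
  then have "(f w, f ?w) \<in> G"
    using AB(5) by blast
  then show False
    using out[OF F(1) w(1)] by contradiction
qed

text \<open>
  The values of \<open>f\<close> at \<open>x\<close> and at \<open>replace_off T a S x\<close> are separated by a product of open sets
  avoiding \<open>G\<close>. A box around the second point restricts only finitely many coordinates; those
  outside \<open>S\<close> form the jump set, because a point that is near \<open>x\<close> on the restricted coordinates
  in \<open>S\<close> enters the box once its coordinates in the jump set are reset.
\<close>

lemma jump_set_outside:
  assumes a: "a \<in> topspace (product_topology X T)"
    and E: "E \<subseteq> topspace (product_topology X T)"
    and inv: "\<And>x F. x \<in> E \<Longrightarrow> finite F \<Longrightarrow> F \<subseteq> T \<Longrightarrow> replace_off T a (T - F) x \<in> E"
    and f: "continuous_map (subtopology (product_topology X T) E) Y f"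
    and x: "x \<in> E" and y: "replace_off T a S x \<in> E"
    and sep: "(f x, f (replace_off T a S x)) \<notin> prod_topology Y Y closure_of G"
  obtains F where "jump_set T X a E f G F" and "F \<inter> S = {}"
proof -
  let ?Z = "subtopology (product_topology X T) E"
  let ?y = "replace_off T a S x"
  have top: "topspace ?Z = E"
    using E by auto
  then have "(f x, f ?y) \<in> topspace (prod_topology Y Y)"
    using x y continuous_map_image_subset_topspace[OF f] by auto
  then obtain W where W: "openin (prod_topology Y Y) W" "(f x, f ?y) \<in> W" "W \<inter> G = {}"
    using sep unfolding in_closure_of by blast
  from openin_prod_topology_alt[THEN iffD1, OF W(1), rule_format, OF W(2)]
  obtain A B where AB: "openin Y A" "openin Y B" "f x \<in> A" "f ?y \<in> B" "A \<times> B \<subseteq> W"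
    by (elim exE conjE)
  have opA: "openin ?Z {w \<in> topspace ?Z. f w \<in> A}"
    and opB: "openin ?Z {w \<in> topspace ?Z. f w \<in> B}"
    using AB by (auto intro: openin_continuous_map_preimage[OF f] simp del: topspace_subtopology)
  have "?y \<in> {w \<in> topspace ?Z. f w \<in> B}"
    using y AB top by simp
  from openin_subtopology_product_box[OF opB this]
  obtain C where fin: "finite {i \<in> T. C i \<noteq> topspace (X i)}"
    and C: "\<forall>i\<in>T. openin (X i) (C i)" "?y \<in> Pi\<^sub>E T C"
    and sub: "Pi\<^sub>E T C \<inter> E \<subseteq> {w \<in> topspace ?Z. f w \<in> B}"
    by (elim exE conjE)
  have yC: "(if i \<in> S then x i else a i) \<in> C i" if "i \<in> T" for i
    using PiE_mem[OF C(2) that] that by (simp add: replace_off_def)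
  define F where "F = {i \<in> T. C i \<noteq> topspace (X i)} - S"
  have F: "finite F" "F \<subseteq> T" "F \<inter> S = {}"
    using fin by (auto simp: F_def)
  define D where "D = (\<lambda>i. if i \<in> S then C i else topspace (X i))"
  have "finite {i \<in> T. D i \<noteq> topspace (X i)}"
    by (rule finite_subset[OF _ fin]) (auto simp: D_def)
  then have "openin (product_topology X T) (Pi\<^sub>E T D)"
    using C(1) by (simp add: openin_PiE_gen D_def)
  then have opD: "openin ?Z (Pi\<^sub>E T D \<inter> E)"
    unfolding openin_subtopology by blast
  define U where "U = {w \<in> topspace ?Z. f w \<in> A} \<inter> (Pi\<^sub>E T D \<inter> E)"
  have "openin ?Z U"
    unfolding U_def using opA opD by (rule openin_Int)
  moreover have "x \<in> U"
  proof -
    have "x i \<in> D i" if "i \<in> T" for i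
      using yC[OF that] that x E by (auto simp: D_def PiE_iff split: if_splits)
    moreover have "x \<in> extensional T"
      using x E by (auto simp: PiE_def)
    ultimately show ?thesis
      using x top AB by (auto simp: U_def PiE_iff)
  qed
  moreover have "(f w, f (replace_off T a (T - F) w)) \<notin> G" if w: "w \<in> U" for w
  proof -
    let ?w = "replace_off T a (T - F) w"
    have wD: "w i \<in> D i" if "i \<in> T" for i
      using w that by (auto simp: U_def dest: PiE_mem)
    have "(if i \<in> T - F then w i else a i) \<in> C i" if i: "i \<in> T" for i
      using yC[OF i] wD[OF i] i by (auto simp: F_def D_def split: if_splits)
    then have "?w \<in> Pi\<^sub>E T C"
      by (auto simp: replace_off_def)
    moreover have "?w \<in> E"
      using inv w F by (simp add: U_def)
    ultimately have "f ?w \<in> B"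
      using sub by auto
    moreover have "f w \<in> A"
      using w by (simp add: U_def)
    ultimately show ?thesis
      using AB W by blast
  qed
  ultimately have "jump_set T X a E f G F"
    using F unfolding jump_set_def by blast
  then show thesis
    using F that by blast
qed

lemma maximal_disjoint_family:
  "\<exists>\<F>. (\<forall>F\<in>\<F>. P F) \<and> pairwise disjnt \<F> \<and> (\<forall>F. P F \<longrightarrow> F \<inter> \<Union>\<F> = {} \<longrightarrow> F \<in> \<F>)"
proof -
  let ?\<A> = "{\<F>. \<F> \<subseteq> Collect P \<and> pairwise disjnt \<F>}"
  have "\<exists>\<M>\<in>?\<A>. \<forall>\<F>\<in>?\<A>. \<M> \<subseteq> \<F> \<longrightarrow> \<F> = \<M>"
  proof (rule subset_Zorn')
    fix \<C> assume "subset.chain ?\<A> \<C>"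
    then show "\<Union>\<C> \<in> ?\<A>"
      using pairwise_chain_Union[of \<C> disjnt] by (auto simp: subset_chain_def chain_subset_def)
  qed
  then obtain \<M> where M: "\<M> \<subseteq> Collect P" "pairwise disjnt \<M>"
    and max: "\<And>\<F>. \<F> \<subseteq> Collect P \<Longrightarrow> pairwise disjnt \<F> \<Longrightarrow> \<M> \<subseteq> \<F> \<Longrightarrow> \<F> = \<M>"
    by auto
  show ?thesis
  proof (intro exI conjI ballI allI impI)
    show "P F" if "F \<in> \<M>" for F
      using M that by blast
    show "pairwise disjnt \<M>"
      by (fact M)
    fix F assume F: "P F" "F \<inter> \<Union>\<M> = {}"
    then have "pairwise disjnt (insert F \<M>)"
      using M by (auto simp: pairwise_insert disjnt_def)
    then have "insert F \<M> = \<M>"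
      using F M by (intro max) auto
    then show "F \<in> \<M>"
      by blast
  qed
qed

section \<open>Factorization through countably many coordinates\<close>

text \<open>
  Composing \<open>f\<close> with the section \<open>replace_off T a S\<close> of the projection gives the factor; it is
  continuous because the section is.
\<close>

lemma continuous_factor_of_replace_off:
  assumes S: "S \<subseteq> T" and a: "a \<in> topspace (product_topology X T)"
    and inv: "\<And>x. x \<in> E \<Longrightarrow> replace_off T a S x \<in> E"
    and f: "continuous_map (subtopology (product_topology X T) E) Y f"
  shows "continuous_map (subtopology (product_topology X S) ((\<lambda>x. restrict x S) ` E)) Y
           (f \<circ> replace_off T a S)"
proof (rule continuous_map_compose[OF _ f])
  have "replace_off T a S ` (\<lambda>x. restrict x S) ` E \<subseteq> E"
    using inv by (auto simp: replace_off_restrict)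
  then show "continuous_map (subtopology (product_topology X S) ((\<lambda>x. restrict x S) ` E))
      (subtopology (product_topology X T) E) (replace_off T a S)"
    using continuous_map_from_subtopology[OF continuous_map_replace_off[OF S a]]
    by (auto simp: continuous_map_in_subtopology)
qed

theorem theorem3p1:
  fixes Y :: "'b topology"
    and X :: "'i \<Rightarrow> 'a topology"
    and T :: "'i set"
    and a :: "'i \<Rightarrow> 'a"
    and E :: "('i \<Rightarrow> 'a) set"
    and f :: "('i \<Rightarrow> 'a) \<Rightarrow> 'b"
  assumes "regular_Gdelta_diagonal Y"
    and "a \<in> topspace (product_topology X T)"
    and "E \<subseteq> topspace (product_topology X T)"
    and "pseudo_aleph1_compact (subtopology (product_topology X T) E)"
    and "invariant_wrt (cardSuc natLeq) natLeq T E a"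
    and "continuous_map (subtopology (product_topology X T) E) Y f"
  shows "(\<exists>T0 f0. T0 \<subseteq> T \<and> countable T0 \<and>
            continuous_map
              (subtopology (product_topology X T0) ((\<lambda>x. restrict x T0) ` E)) Y f0 \<and>
            (\<forall>x\<in>E. f x = f0 (restrict x T0)))
         \<and> depends_on_countably_many T E f"
proof -
  note a = assms(2) and E = assms(3) and comp = assms(4) and f = assms(6)
  obtain G :: "nat \<Rightarrow> ('b \<times> 'b) set" where G: "\<forall>n. openin (prod_topology Y Y) (G n)"
    and diag: "{(y, y) | y. y \<in> topspace Y} = (\<Inter>n. G n)"
    and diag_cl: "{(y, y) | y. y \<in> topspace Y} = (\<Inter>n. prod_topology Y Y closure_of G n)"
    using assms(1) unfolding regular_Gdelta_diagonal_def by (elim exE conjE)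
  have diagG: "(y, y) \<in> G n" if "y \<in> topspace Y" for y n
  proof -
    have "(y, y) \<in> (\<Inter>n. G n)"
      unfolding diag[symmetric] using that by simp
    then show ?thesis
      by simp
  qed
  have inv: "replace_off T a S1 x \<in> E \<and> replace_off T a (T - S2) x \<in> E"
    if "x \<in> E" "S1 \<subseteq> T" "S2 \<subseteq> T" "|S1| <o cardSuc natLeq" "|S2| <o natLeq" for x S1 S2
    using assms(5) that by (simp add: invariant_wrt_def)
  have inv_fin: "replace_off T a (T - F) x \<in> E" if "x \<in> E" "finite F" "F \<subseteq> T" for x F
  proof -
    have "|{} :: 'i set| <o cardSuc natLeq"
      unfolding card_less_aleph1_iff by simp
    moreover have "|F| <o natLeq"
      using that(2) unfolding card_less_aleph0_iff .
    ultimately show ?thesis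
      using inv[of x "{}" F] that by simp
  qed
  have inv_count: "replace_off T a S x \<in> E" if "x \<in> E" "countable S" "S \<subseteq> T" for x S
  proof -
    have "|{} :: 'i set| <o natLeq"
      unfolding card_less_aleph0_iff by simp
    moreover have "|S| <o cardSuc natLeq"
      using that(2) unfolding card_less_aleph1_iff .
    ultimately show ?thesis
      using inv[of x S "{}"] that by simp
  qed
  have "\<forall>n. \<exists>\<F>. (\<forall>F\<in>\<F>. jump_set T X a E f (G n) F) \<and> pairwise disjnt \<F> \<and>
          (\<forall>F. jump_set T X a E f (G n) F \<longrightarrow> F \<inter> \<Union>\<F> = {} \<longrightarrow> F \<in> \<F>)"
    by (intro allI maximal_disjoint_family)
  from choice[OF this] obtain \<F> where
    \<F>: "\<forall>n. (\<forall>F\<in>\<F> n. jump_set T X a E f (G n) F) \<and> pairwise disjnt (\<F> n) \<and>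
          (\<forall>F. jump_set T X a E f (G n) F \<longrightarrow> F \<inter> \<Union>(\<F> n) = {} \<longrightarrow> F \<in> \<F> n)"
    by (elim exE)
  have jump: "jump_set T X a E f (G n) F" if "F \<in> \<F> n" for n F
    using \<F> that by simp
  have disj: "pairwise disjnt (\<F> n)" for n
    using \<F> by simp
  have max: "F \<in> \<F> n" if "jump_set T X a E f (G n) F" "F \<inter> \<Union>(\<F> n) = {}" for n F
    using \<F> that by simp
  define T0 where "T0 = (\<Union>n. \<Union>F\<in>\<F> n. F)"
  have count: "countable (\<F> n)" for n
    using a comp inv_fin f G[rule_format] diagG jump disj by (rule countable_disjoint_jump_sets)
  have jump_fin: "finite F" "F \<subseteq> T" if "F \<in> \<F> n" for F n
    using jump[OF that] unfolding jump_set_def by auto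
  have T0: "countable T0" "T0 \<subseteq> T"
  proof -
    show "countable T0"
      unfolding T0_def using count jump_fin(1) by (intro countable_UN) (auto intro: countable_finite)
    show "T0 \<subseteq> T"
      unfolding T0_def by (intro UN_least jump_fin(2))
  qed
  have key: "f (replace_off T a T0 x) = f x" if x: "x \<in> E" for x
  proof (rule ccontr)
    assume "f (replace_off T a T0 x) \<noteq> f x"
    then obtain n where "(f x, f (replace_off T a T0 x)) \<notin> prod_topology Y Y closure_of G n"
      using diag_cl by blast
    with a E inv_fin f x inv_count[OF x T0]
    obtain F where F: "jump_set T X a E f (G n) F" "F \<inter> T0 = {}"
      by (rule jump_set_outside)
    then have "F \<in> \<F> n"
      by (intro max) (auto simp: T0_def)
    \<comment> \<open>Members of the family are subsets of \<open>T0\<close>, but \<open>F\<close> was found disjoint from \<open>T0\<close>.\<close>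
    then have "F = {}"
      using F(2) unfolding T0_def by blast
    then show False
      using jump_set_nonempty[OF F(1) f diagG] by blast
  qed
  have "continuous_map (subtopology (product_topology X T0) ((\<lambda>x. restrict x T0) ` E)) Y
          (f \<circ> replace_off T a T0)"
    by (rule continuous_factor_of_replace_off[OF T0(2) a inv_count[OF _ T0] f])
  moreover have factor: "f x = (f \<circ> replace_off T a T0) (restrict x T0)" if "x \<in> E" for x
    using key[OF that] by (simp add: replace_off_restrict)
  moreover have "depends_on E f T0"
    unfolding depends_on_def
  proof (intro ballI impI)
    fix x y assume "x \<in> E" "y \<in> E" "restrict x T0 = restrict y T0"
    then show "f x = f y"
      using factor[of x] factor[of y] by simp
  qed
  ultimately show ?thesis
    unfolding depends_on_countably_many_def using T0
    by (intro conjI exI[of _ T0] exI[of _ "f \<circ> replace_off T a T0"] ballI)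
qed

end
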